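(* Let $p$ be a prime, let $R=(r_n)_{n\in\mathbb{N}}$ be an almost sparse sequence of integers, and let $p^R=\{p^r\in\mathbb{Q}_p\mid r\in R\}$. Then the Poincaré series of $p^R$ is not a rational function.
   Context: **Poincaré series.** For a subset $A$ of $\mathbb{Z}_p^n$ and $m\ge0$, let $N_m$ be the cardinality of $\{(x_1\bmod p^m,\dots,x_n\bmod p^m)\in(\mathbb{Z}/p^m\mathbb{Z})^n\mid \overline{x}\in A\}$. The Poincaré series of $A$ is the formal power series $P_A(T)=\sum_{m=0}^\infty N_mT^m$. **Almost sparse sequences.** Let $R=(r_n)_{n\in\mathbb{N}}$ be a strictly increasing sequence of integers, also regarded as the set $\{r_n\mid n\in\mathbb{N}\}$. Put $S(r_n)=r_{n+1}$, $S^{-1}(r_{n+1})=r_n$, $S^{-1}(r_0)=r_0$, and let $S^i$ ($i\in\mathbb{Z}$) denote the iterates. An operator on $R$ is a term of the form $A(x)=\sum_{i=-n}^m z_iS^i(x)$ with $z_i\in\mathbb{Z}$. For operators $A,B$, write $A>_{ae}B$ if $A(a)>B(a)$ for all but finitely many $a\in R$; the relations $<_{ae}$ and $=_{ae}$ are defined similarly. $R$ is almost sparse if: (1) for any operators $A,B$, one of $A>_{ae}B$, $A<_{ae}B$, $A=_{ae}B$ holds; (2) for any operators $A,B$ with $A>_{ae}B$, there exists an integer $\Delta\ge0$ such that $A(S^\Delta(x))>_{ae}B(S^\Delta(x))+x$. *)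

theory Defs
  imports
    Berlekamp_Zassenhaus.Finite_Field
    "HOL-Analysis.Finite_Cartesian_Product"
    "HOL-Computational_Algebra.Fraction_Field"
    "HOL-Computational_Algebra.Polynomial_FPS"
begin

unbundle no fps_syntax

section \<open>The \<open>p\<close>-adic integers and the \<open>p\<close>-adic numbers\<close>

text \<open>
  The prime \<open>p\<close> is the cardinality of the type parameter \<open>'p :: prime_card\<close>. A \<open>p\<close>-adic
  integer is an element of the inverse limit of the rings \<open>\<int>/p\<^sup>m\<int>\<close>, where \<open>\<int>/p\<^sup>m\<int>\<close> is
  represented by \<open>{0..<p^m}\<close>.
\<close>

typedef (overloaded) ('p :: prime_card) padic_int =
  "{x :: nat \<Rightarrow> int. \<forall>m. x m \<in> {0..<int CARD('p) ^ m} \<and> x (Suc m) mod int CARD('p) ^ m = x m}"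
  morphisms residue Abs_padic_int
  by (rule exI[of _ "\<lambda>_. 0"]) simp

setup_lifting type_definition_padic_int

lemma card_pow_pos [simp]: "0 < int CARD('p :: prime_card) ^ m"
  by simp

lemma residue_mod_Suc:
  "residue (x :: 'p :: prime_card padic_int) (Suc m) mod int CARD('p) ^ m = residue x m"
  using residue[of x] by auto

lemma residue_range:
  "residue (x :: 'p :: prime_card padic_int) m \<in> {0..<int CARD('p) ^ m}"
  using residue[of x] by auto

lemma residue_mod_self [simp]:
  "residue (x :: 'p :: prime_card padic_int) m mod int CARD('p) ^ m = residue x m"
  using residue_range[of x m] by simp

lemma residue_mod:
  assumes "k \<le> m"
  shows "residue (x :: 'p :: prime_card padic_int) m mod int CARD('p) ^ k = residue x k"
  using assms
proof (induction m rule: dec_induct)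
  case base
  show ?case by simp
next
  case (step m)
  have "int CARD('p) ^ k dvd int CARD('p) ^ m"
    using step.hyps by (intro le_imp_power_dvd) simp
  then have "residue x (Suc m) mod int CARD('p) ^ k
      = residue x (Suc m) mod int CARD('p) ^ m mod int CARD('p) ^ k"
    by (simp add: mod_mod_cancel)
  then show ?case by (simp only: residue_mod_Suc step.IH)
qed

lemma padic_int_eqI:
  "(\<And>m. residue x m = residue y m) \<Longrightarrow> x = (y :: 'p :: prime_card padic_int)"
  by (metis residue_inject ext)

lemma coherent_mod:
  fixes x :: "nat \<Rightarrow> int"
  assumes "x (Suc m) mod int CARD('p :: prime_card) ^ m = x m mod int CARD('p) ^ m"
  shows "x m mod int CARD('p) ^ m \<in> {0..<int CARD('p) ^ m} \<and>
    x (Suc m) mod int CARD('p) ^ Suc m mod int CARD('p) ^ m = x m mod int CARD('p) ^ m"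
  using assms by (simp add: mod_mod_cancel)

instantiation padic_int :: (prime_card) idom
begin

lift_definition zero_padic_int :: "'a padic_int" is "\<lambda>m. 0 mod int CARD('a) ^ m"
  by (rule coherent_mod[where x = "\<lambda>_. 0"]) simp

lift_definition one_padic_int :: "'a padic_int" is "\<lambda>m. 1 mod int CARD('a) ^ m"
  by (rule coherent_mod[where x = "\<lambda>_. 1"]) simp

lift_definition plus_padic_int :: "'a padic_int \<Rightarrow> 'a padic_int \<Rightarrow> 'a padic_int"
  is "\<lambda>x y m. (x m + y m) mod int CARD('a) ^ m"
  subgoal for x y m
    by (rule coherent_mod[where x = "\<lambda>m. x m + y m"], rule mod_add_cong) (metis mod_mod_trivial)+
  done

lift_definition times_padic_int :: "'a padic_int \<Rightarrow> 'a padic_int \<Rightarrow> 'a padic_int"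
  is "\<lambda>x y m. (x m * y m) mod int CARD('a) ^ m"
  subgoal for x y m
    by (rule coherent_mod[where x = "\<lambda>m. x m * y m"], rule mod_mult_cong) (metis mod_mod_trivial)+
  done

lift_definition uminus_padic_int :: "'a padic_int \<Rightarrow> 'a padic_int"
  is "\<lambda>x m. (- x m) mod int CARD('a) ^ m"
  subgoal for x m
    by (rule coherent_mod[where x = "\<lambda>m. - x m"], rule mod_minus_cong) (metis mod_mod_trivial)
  done

lift_definition minus_padic_int :: "'a padic_int \<Rightarrow> 'a padic_int \<Rightarrow> 'a padic_int"
  is "\<lambda>x y m. (x m - y m) mod int CARD('a) ^ m"
  subgoal for x y m
    by (rule coherent_mod[where x = "\<lambda>m. x m - y m"], rule mod_diff_cong) (metis mod_mod_trivial)+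
  done

lemma padic_int_mult_nonzero:
  fixes x y :: "'a padic_int"
  assumes "x \<noteq> 0" "y \<noteq> 0"
  shows "x * y \<noteq> 0"
proof
  let ?p = "int CARD('a)"
  assume eq: "x * y = 0"
  obtain a where a: "residue x a \<noteq> 0"
    using padic_int_eqI[of x 0] \<open>x \<noteq> 0\<close> by (auto simp: zero_padic_int.rep_eq)
  obtain b where b: "residue y b \<noteq> 0"
    using padic_int_eqI[of y 0] \<open>y \<noteq> 0\<close> by (auto simp: zero_padic_int.rep_eq)
  let ?u = "residue x (a + b)" and ?v = "residue y (a + b)"
  have u: "\<not> ?p ^ a dvd ?u"
    using a residue_mod[of a "a + b" x] by (simp add: dvd_eq_mod_eq_0)
  have v: "\<not> ?p ^ b dvd ?v"
    using b residue_mod[of b "a + b" y] by (simp add: dvd_eq_mod_eq_0)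
  have p: "prime_elem ?p" using prime_card_int[where 'a = 'a] by simp
  have nu: "\<not> is_unit ?p" using p by (rule prime_elem_not_unit)
  have nz: "?u \<noteq> 0" "?v \<noteq> 0" using u v by auto
  have "multiplicity ?p ?u < a" "multiplicity ?p ?v < b"
    using u v nz nu by (simp_all add: multiplicity_lessI)
  then have "multiplicity ?p (?u * ?v) < a + b"
    using prime_elem_multiplicity_mult_distrib[OF p nz] by simp
  moreover have "?p ^ (a + b) dvd ?u * ?v"
    using arg_cong[OF eq, of "\<lambda>z. residue z (a + b)"]
    by (simp add: times_padic_int.rep_eq zero_padic_int.rep_eq dvd_eq_mod_eq_0)
  ultimately show False
    using multiplicity_geI[of "?u * ?v" ?p "a + b"] nz nu by auto
qed

instance
proof
  fix a b c :: "'a padic_int"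
  show "a * b * c = a * (b * c)"
    by (rule padic_int_eqI) (simp add: times_padic_int.rep_eq mod_simps algebra_simps)
  show "a * b = b * a"
    by (rule padic_int_eqI) (simp add: times_padic_int.rep_eq algebra_simps)
  show "1 * a = a"
    by (rule padic_int_eqI) (simp add: times_padic_int.rep_eq one_padic_int.rep_eq mod_simps)
  show "a + b + c = a + (b + c)"
    by (rule padic_int_eqI) (simp add: plus_padic_int.rep_eq mod_simps algebra_simps)
  show "a + b = b + a"
    by (rule padic_int_eqI) (simp add: plus_padic_int.rep_eq algebra_simps)
  show "0 + a = a"
    by (rule padic_int_eqI) (simp add: plus_padic_int.rep_eq zero_padic_int.rep_eq)
  show "- a + a = 0"
    by (rule padic_int_eqI)
      (simp add: plus_padic_int.rep_eq zero_padic_int.rep_eq uminus_padic_int.rep_eq mod_simps)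
  show "a - b = a + - b"
    by (rule padic_int_eqI)
      (simp add: plus_padic_int.rep_eq minus_padic_int.rep_eq uminus_padic_int.rep_eq mod_simps)
  show "(a + b) * c = a * c + b * c"
    by (rule padic_int_eqI)
      (simp add: plus_padic_int.rep_eq times_padic_int.rep_eq mod_simps algebra_simps)
  show "a * (b + c) = a * b + a * c"
    by (rule padic_int_eqI)
      (simp add: plus_padic_int.rep_eq times_padic_int.rep_eq mod_simps algebra_simps)
  show "0 * a = 0" "a * 0 = 0"
    by (rule padic_int_eqI; simp add: times_padic_int.rep_eq zero_padic_int.rep_eq)+
  show "(0 :: 'a padic_int) \<noteq> 1"
  proof
    assume "(0 :: 'a padic_int) = 1"
    from arg_cong[OF this, of "\<lambda>z. residue z 1"] show False
      using prime_gt_1_nat[OF prime_card[where 'a = 'a]]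
      by (simp add: zero_padic_int.rep_eq one_padic_int.rep_eq)
  qed
  show "a \<noteq> 0 \<Longrightarrow> b \<noteq> 0 \<Longrightarrow> a * b \<noteq> 0"
    by (rule padic_int_mult_nonzero)
qed

end

type_synonym 'p padic = "'p padic_int fract"

definition of_padic_int :: "'p :: prime_card padic_int \<Rightarrow> 'p padic" where
  "of_padic_int x = Fract x 1"


section \<open>Poincare series\<close>

text \<open>
  The tuple \<open>(x\<^sub>1, \<dots>, x\<^sub>n)\<close> ranges over \<open>\<int>\<^sub>p\<^sup>n\<close>, so for \<open>A\<close> inside \<open>\<rat>\<^sub>p\<^sup>n\<close> only the integral
  points of \<open>A\<close> contribute.
\<close>

definition poincare_coeff :: "('p :: prime_card padic ^ 'n) set \<Rightarrow> nat \<Rightarrow> nat" where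
  "poincare_coeff A m =
     card {(\<chi> i. residue (x $ i) m) | x :: 'p padic_int ^ 'n. (\<chi> i. of_padic_int (x $ i)) \<in> A}"

definition poincare_series :: "('p :: prime_card padic ^ 'n) set \<Rightarrow> rat fps" where
  "poincare_series A = Abs_fps (\<lambda>m. of_nat (poincare_coeff A m))"

definition rational_fps :: "'a :: field fps \<Rightarrow> bool" where
  "rational_fps F \<longleftrightarrow>
     (\<exists>P Q :: 'a poly. Q \<noteq> 0 \<and> F * fps_of_poly Q = fps_of_poly P)"

definition prime_powers_at :: "int set \<Rightarrow> 'p :: prime_card padic set" where
  "prime_powers_at R = {of_nat CARD('p) powi r | r. r \<in> R}"


section \<open>Almost sparse sequences\<close>

text \<open>
  The shift and its inverse are functions on the range of the (injective) sequence \<open>r\<close>; their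
  values elsewhere are irrelevant. Truncated subtraction gives \<open>S\<^sup>-\<^sup>1(r\<^sub>0) = r\<^sub>0\<close>.
\<close>

definition shift :: "(nat \<Rightarrow> int) \<Rightarrow> int \<Rightarrow> int" where
  "shift r x = r (Suc (inv_into UNIV r x))"

definition shift_back :: "(nat \<Rightarrow> int) \<Rightarrow> int \<Rightarrow> int" where
  "shift_back r x = r (inv_into UNIV r x - 1)"

definition shift_iter :: "(nat \<Rightarrow> int) \<Rightarrow> int \<Rightarrow> int \<Rightarrow> int" where
  "shift_iter r i = (if 0 \<le> i then shift r ^^ nat i else shift_back r ^^ nat (- i))"

definition is_operator :: "(nat \<Rightarrow> int) \<Rightarrow> (int \<Rightarrow> int) \<Rightarrow> bool" where
  "is_operator r A \<longleftrightarrow>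
     (\<exists>(n :: nat) (m :: nat) (z :: int \<Rightarrow> int).
        A = (\<lambda>x. \<Sum>i = - int n..int m. z i * shift_iter r i x))"

definition ae :: "(nat \<Rightarrow> int) \<Rightarrow> (int \<Rightarrow> bool) \<Rightarrow> bool" where
  "ae r P \<longleftrightarrow> finite {a \<in> range r. \<not> P a}"

definition almost_sparse :: "(nat \<Rightarrow> int) \<Rightarrow> bool" where
  "almost_sparse r \<longleftrightarrow>
     strict_mono r \<and>
     (\<forall>A B. is_operator r A \<and> is_operator r B \<longrightarrow>
        ae r (\<lambda>a. A a > B a) \<or> ae r (\<lambda>a. A a < B a) \<or> ae r (\<lambda>a. A a = B a)) \<and>
     (\<forall>A B. is_operator r A \<and> is_operator r B \<and> ae r (\<lambda>a. A a > B a) \<longrightarrow>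
        (\<exists>d :: nat. ae r (\<lambda>a. A (shift_iter r (int d) a) > B (shift_iter r (int d) a) + a)))"

end

theory Submission
  imports Defs
begin

text \<open>
  The integral points of \<open>p\<^sup>R\<close> are the powers \<open>p\<^sup>n\<close> with \<open>n \<in> R\<close> a natural number. Modulo \<open>p\<^sup>m\<close>
  those with \<open>n < m\<close> are pairwise distinct and nonzero, and all others collapse to \<open>0\<close>, a value that
  is attained because \<open>R\<close> is unbounded. Hence \<open>N\<^sub>m = 1 + card {n < m. n \<in> R}\<close>
  (\<open>poincare_coeff_prime_powers\<close>), and multiplying the Poincare series by \<open>1 - T\<close> turns it into
  \<open>1 + T \<cdot> (\<Sum>n\<in>R \<inter> \<nat>. T\<^sup>n)\<close>, essentially the indicator series of \<open>R \<inter> \<nat>\<close>.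

  A rational series satisfies a linear recurrence, so a sufficiently long run of vanishing
  coefficients forces all later ones to vanish: nonzero coefficients come at bounded distance
  (\<open>rational_fps_nonzero_coeff_nearby\<close>). On the other hand, condition (2) of almost sparseness,
  applied to \<open>S(x) - x\<close> and \<open>0\<close>, says that some gap shortly after \<open>x\<close> exceeds \<open>x\<close>, so the gaps of
  \<open>R\<close> are unbounded (\<open>almost_sparse_gaps_unbounded\<close>). The two are incompatible.
\<close>

section \<open>Rational power series have no long gaps\<close>

lemma rational_fps_mult_poly:
  assumes "rational_fps F"
  shows "rational_fps (F * fps_of_poly G)"
proof -
  obtain P Q where "Q \<noteq> 0" "F * fps_of_poly Q = fps_of_poly P"
    using assms unfolding rational_fps_def by blast
  then have "F * fps_of_poly G * fps_of_poly Q = fps_of_poly (P * G)"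
    by (metis fps_of_poly_mult mult.assoc mult.commute)
  with \<open>Q \<noteq> 0\<close> show ?thesis unfolding rational_fps_def by blast
qed

text \<open>
  If \<open>F \<cdot> Q\<close> is a polynomial and \<open>q\<^sub>j\<close> is the lowest nonzero coefficient of \<open>Q\<close>, then comparing
  coefficients of large degree \<open>a + j\<close> writes \<open>q\<^sub>j f\<^sub>a\<close> as a combination of the coefficients of \<open>F\<close> of
  index below \<open>a\<close> and at least \<open>a - deg Q\<close>. If all of these vanish, so does \<open>f\<^sub>a\<close>.
\<close>

lemma rational_fps_nonzero_coeff_nearby:
  assumes "rational_fps F"
  obtains N d where
    "\<And>a. a \<ge> N \<Longrightarrow> fps_nth F a \<noteq> 0 \<Longrightarrow> \<exists>k<a. a \<le> k + d \<and> fps_nth F k \<noteq> 0"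
proof -
  obtain P Q where Q: "Q \<noteq> 0" and eq: "F * fps_of_poly Q = fps_of_poly P"
    using assms unfolding rational_fps_def by blast
  define j where "j = (LEAST j. coeff Q j \<noteq> 0)"
  have j: "coeff Q j \<noteq> 0"
    unfolding j_def by (rule LeastI[of _ "degree Q"]) (simp add: Q)
  have below_j: "coeff Q i = 0" if "i < j" for i
    using that not_less_Least unfolding j_def by blast
  show thesis
  proof (rule that[of "Suc (degree P)" "degree Q"], rule ccontr)
    fix a
    assume a: "a \<ge> Suc (degree P)" "fps_nth F a \<noteq> 0"
      and none: "\<not> (\<exists>k<a. a \<le> k + degree Q \<and> fps_nth F k \<noteq> 0)"
    have "fps_nth F k * coeff Q (a + j - k) = 0" if "k \<le> a + j" "k \<noteq> a" for k
    proof (cases "k < a")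
      case True
      then show ?thesis
        using none coeff_eq_0[of Q "a + j - k"] by (cases "a \<le> k + degree Q") auto
    next
      case False
      then show ?thesis using that by (auto intro: below_j)
    qed
    then have "(\<Sum>k\<in>{0..a + j} - {a}. fps_nth F k * coeff Q (a + j - k)) = 0"
      by (intro sum.neutral) simp
    then have "fps_nth (F * fps_of_poly Q) (a + j) = fps_nth F a * coeff Q j"
      by (subst fps_mult_nth, subst sum.remove[of _ a]) simp_all
    moreover have "fps_nth (F * fps_of_poly Q) (a + j) = 0"
      using a by (simp add: eq coeff_eq_0)
    ultimately show False using a j by simp
  qed
qed


section \<open>Almost sparse sequences have unbounded gaps\<close>

lemma strict_mono_int_growth:
  fixes r :: "nat \<Rightarrow> int"
  assumes "strict_mono r"
  shows "r 0 + int n \<le> r n"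
proof (induction n)
  case (Suc n)
  have "r n < r (Suc n)" using assms by (simp add: strict_mono_Suc_iff)
  with Suc show ?case by simp
qed simp

lemma shift_iter_nonneg:
  assumes "strict_mono r"
  shows "shift_iter r (int k) (r n) = r (n + k)"
proof -
  have "inj r" using assms by (rule strict_mono_imp_inj_on)
  then have "(shift r ^^ k) (r n) = r (n + k)"
    by (induction k) (simp_all add: shift_def)
  then show ?thesis by (simp add: shift_iter_def)
qed

lemma ae_range_eventually:
  assumes "strict_mono r" and "ae r P"
  shows "\<forall>\<^sub>F n in sequentially. P (r n)"
proof -
  have "finite (r -` {a \<in> range r. \<not> P a})"
    using assms strict_mono_imp_inj_on[of r UNIV]
    unfolding ae_def by (intro finite_vimageI) auto
  moreover have "r -` {a \<in> range r. \<not> P a} = {n. \<not> P (r n)}" by auto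
  ultimately show ?thesis
    by (simp add: eventually_cofinite cofinite_eq_sequentially[symmetric])
qed

lemma ae_rangeI:
  assumes "\<And>n. P (r n)"
  shows "ae r P"
proof -
  have "{a \<in> range r. \<not> P a} = {}" using assms by blast
  then show ?thesis unfolding ae_def by (simp only: finite.emptyI)
qed

text \<open>
  The operator \<open>S(x) - x\<close> is positive on \<open>R\<close>, so for some \<open>d\<close> the gap that starts \<open>d\<close> places after
  \<open>x\<close> is larger than \<open>x\<close> for almost all \<open>x \<in> R\<close>, and \<open>x\<close> itself is unbounded.
\<close>

lemma almost_sparse_gaps_unbounded:
  assumes sparse: "almost_sparse r"
  shows "\<exists>n\<ge>M. r (Suc n) - r n > D"
proof -
  have mono: "strict_mono r" using sparse unfolding almost_sparse_def by blast
  define A where "A = (\<lambda>x. \<Sum>i = - int 0..int 1. (if i = 0 then - 1 else 1) * shift_iter r i x)"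
  define B where "B = (\<lambda>x. \<Sum>i = - int 0..int 0. 0 * shift_iter r i x)"
  have "is_operator r A"
    unfolding is_operator_def A_def
    by (rule exI[of _ 0], rule exI[of _ 1],
        rule exI[of _ "\<lambda>i. if i = 0 then - 1 else 1"]) (rule refl)
  moreover have "is_operator r B"
    unfolding is_operator_def B_def
    by (rule exI[of _ 0], rule exI[of _ 0], rule exI[of _ "\<lambda>i. 0"]) (rule refl)
  ultimately have ops: "is_operator r A" "is_operator r B" .
  have "{- int 0..int 1} = {0, 1}" by auto
  then have A: "A (r n) = r (Suc n) - r n" for n
    using shift_iter_nonneg[OF mono, of 0 n] shift_iter_nonneg[OF mono, of 1 n]
    by (simp add: A_def)
  have B: "B x = 0" for x by (simp add: B_def)
  have "ae r (\<lambda>a. A a > B a)"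
    using mono by (intro ae_rangeI) (simp add: A B strict_mono_Suc_iff)
  with sparse ops obtain d where
    "ae r (\<lambda>a. A (shift_iter r (int d) a) > B (shift_iter r (int d) a) + a)"
    unfolding almost_sparse_def by blast
  from ae_range_eventually[OF mono this]
  have "\<forall>\<^sub>F n in sequentially. r (Suc (n + d)) - r (n + d) > r n"
    by (simp add: shift_iter_nonneg[OF mono] A B)
  moreover have "\<forall>\<^sub>F n in sequentially. n \<ge> max M (nat (D - r 0))"
    by (rule eventually_ge_at_top)
  ultimately have "\<forall>\<^sub>F n in sequentially. r (Suc (n + d)) - r (n + d) > D \<and> n + d \<ge> M"
  proof eventually_elim
    case (elim n)
    then show ?case using strict_mono_int_growth[OF mono, of n] by linarith
  qed
  then obtain n where "r (Suc (n + d)) - r (n + d) > D \<and> n + d \<ge> M"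
    using eventually_happens'[OF sequentially_bot] by blast
  then show ?thesis by blast
qed


section \<open>Integral powers of the prime\<close>

lemma residue_of_nat:
  "residue (of_nat k :: 'p :: prime_card padic_int) m = int k mod int CARD('p) ^ m"
  by (induction k)
    (simp_all add: zero_padic_int.rep_eq one_padic_int.rep_eq plus_padic_int.rep_eq mod_simps)

lemma residue_prime_power:
  "residue (of_nat CARD('p) ^ n :: 'p :: prime_card padic_int) m
    = (if n < m then int CARD('p) ^ n else 0)"
proof -
  have p: "1 < CARD('p)" using prime_gt_1_nat[OF prime_card] .
  have "residue (of_nat CARD('p) ^ n :: 'p padic_int) m = int CARD('p) ^ n mod int CARD('p) ^ m"
    using residue_of_nat[of "CARD('p) ^ n" m, where 'p = 'p] by simp
  then show ?thesis using p by (simp add: le_imp_power_dvd)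
qed

text \<open>
  A negative power of \<open>p\<close> is never integral: an integral value would be an inverse in \<open>\<int>\<^sub>p\<close> of a
  positive power of \<open>p\<close>, whose image in the residue field is \<open>0\<close>.
\<close>

lemma of_padic_int_eq_prime_powi_iff:
  fixes x :: "'p :: prime_card padic_int"
  shows "of_padic_int x = of_nat CARD('p) powi r
    \<longleftrightarrow> (\<exists>n. r = int n \<and> x = of_nat CARD('p) ^ n)"
proof -
  let ?p = "of_nat CARD('p) :: 'p padic_int"
  have power: "(of_nat CARD('p) :: 'p padic) ^ n = Fract (?p ^ n) 1" for n
    using of_nat_fract[of "CARD('p) ^ n", where 'a = "'p padic_int"] by simp
  show ?thesis
  proof (cases "r \<ge> 0")
    case True
    then obtain n where "r = int n" using nonneg_int_cases by blast
    then show ?thesis by (simp add: of_padic_int_def power eq_fract)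
  next
    case False
    then obtain n where r: "r = - int (Suc n)" by (metis not_le int_cases nless_le of_nat_0_le_iff)
    have "residue ?p 2 \<noteq> 0"
      using residue_prime_power[of 1 2, where 'p = 'p] by simp
    then have nz: "?p \<noteq> 0" by (auto simp: zero_padic_int.rep_eq)
    have "of_padic_int x \<noteq> of_nat CARD('p) powi r"
    proof
      assume "of_padic_int x = of_nat CARD('p) powi r"
      then have "Fract x 1 = Fract 1 (?p ^ Suc n)"
        by (simp only: of_padic_int_def r power_int_minus power_int_of_nat power inverse_fract)
      then have "x * ?p ^ Suc n = 1"
        using nz eq_fract(1)[of 1 "?p ^ Suc n" x 1] by simp
      then have "residue (x * ?p ^ Suc n) 1 = residue (1 :: 'p padic_int) 1" by (rule arg_cong)
      moreover have "residue (x * ?p ^ Suc n) 1 = 0"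
        by (simp only: times_padic_int.rep_eq residue_prime_power) simp
      ultimately show False
        using prime_gt_1_nat[OF prime_card[where 'a = 'p]] by (simp add: one_padic_int.rep_eq)
    qed
    then show ?thesis using False by auto
  qed
qed


section \<open>The Poincare series of the set of prime powers\<close>

lemma poincare_coeff_prime_powers:
  fixes r :: "nat \<Rightarrow> int"
  assumes mono: "strict_mono r"
  shows "poincare_coeff {vec x :: 'p :: prime_card padic ^ 1 | x. x \<in> prime_powers_at (range r)} m
    = Suc (card {n. n < m \<and> int n \<in> range r})"
proof -
  let ?p = "of_nat CARD('p) :: 'p padic_int"
  let ?A = "{vec x :: 'p padic ^ 1 | x. x \<in> prime_powers_at (range r)}"
  let ?V = "\<lambda>z. (\<chi> i. z) :: int ^ 1"
  let ?B = "{n. n < m \<and> int n \<in> range r}"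
  have p: "1 < int CARD('p)" using prime_gt_1_nat[OF prime_card[where 'a = 'p]] by simp
  have mem: "(\<chi> i. of_padic_int (x $ i)) \<in> ?A \<longleftrightarrow> (\<exists>n. int n \<in> range r \<and> x $ 1 = ?p ^ n)"
    for x :: "'p padic_int ^ 1"
  proof -
    have "(\<chi> i. of_padic_int (x $ i)) \<in> ?A \<longleftrightarrow> of_padic_int (x $ 1) \<in> prime_powers_at (range r)"
      by (auto simp: vec_eq_iff forall_1)
    also have "\<dots> \<longleftrightarrow> (\<exists>s\<in>range r. of_padic_int (x $ 1) = of_nat CARD('p) powi s)"
      unfolding prime_powers_at_def by blast
    also have "\<dots> \<longleftrightarrow> (\<exists>n. int n \<in> range r \<and> x $ 1 = ?p ^ n)"
      unfolding of_padic_int_eq_prime_powi_iff by metis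
    finally show ?thesis .
  qed
  have "{(\<chi> i. residue (x $ i) m) | x :: 'p padic_int ^ 1. (\<chi> i. of_padic_int (x $ i)) \<in> ?A}
      = ?V ` {residue (?p ^ n) m | n. int n \<in> range r}" (is "?L = ?R")
  proof
    show "?L \<subseteq> ?R"
      unfolding mem by (fastforce simp: vec_eq_iff forall_1)
    show "?R \<subseteq> ?L"
    proof
      fix v
      assume "v \<in> ?R"
      then obtain n where n: "int n \<in> range r" "v = ?V (residue (?p ^ n) m)" by blast
      have "v = (\<chi> i. residue ((vec (?p ^ n) :: 'p padic_int ^ 1) $ i) m)"
        using n by (simp add: vec_eq_iff)
      moreover have "(\<chi> i. of_padic_int ((vec (?p ^ n) :: 'p padic_int ^ 1) $ i)) \<in> ?A"
        unfolding mem using n by auto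
      ultimately show "v \<in> ?L" by blast
    qed
  qed
  moreover have "inj ?V" by (rule injI) (simp add: vec_eq_iff)
  ultimately have "poincare_coeff ?A m = card {residue (?p ^ n) m | n. int n \<in> range r}"
    unfolding poincare_coeff_def by (simp add: card_image inj_on_subset)
  also have "{residue (?p ^ n) m | n. int n \<in> range r} = insert 0 ((\<lambda>n. int CARD('p) ^ n) ` ?B)"
  proof -
    \<comment> \<open>unboundedness of the exponents makes \<open>0\<close> one of the residues\<close>
    define k where "k = m + nat (- r 0)"
    have "r k \<ge> int m"
      using strict_mono_int_growth[OF mono, of k] unfolding k_def by linarith
    then have "\<exists>n\<ge>m. int n \<in> range r"
      by (intro exI[of _ "nat (r k)"]) (auto simp: le_nat_iff)
    then show ?thesis unfolding residue_prime_power by (auto simp: image_iff; metis not_le)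
  qed
  also have "card \<dots> = Suc (card ?B)"
  proof -
    have "inj_on (\<lambda>n. int CARD('p) ^ n) ?B"
      using p by (auto intro!: inj_onI simp: power_inject_exp)
    moreover have "0 \<notin> (\<lambda>n. int CARD('p) ^ n) ` ?B" using p by auto
    ultimately show ?thesis by (simp add: card_image)
  qed
  finally show ?thesis .
qed

lemma poincare_series_prime_powers_diff:
  fixes r :: "nat \<Rightarrow> int"
  assumes "strict_mono r"
  shows "fps_nth (poincare_series
      {vec x :: 'p :: prime_card padic ^ 1 | x. x \<in> prime_powers_at (range r)}
      * fps_of_poly [:1, -1:]) (Suc m) = (if int m \<in> range r then 1 else 0)"
proof -
  have "{n. n < Suc m \<and> int n \<in> range r}
      = (if int m \<in> range r then {m} else {}) \<union> {n. n < m \<and> int n \<in> range r}"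
    by (auto simp: less_Suc_eq)
  then have "card {n. n < Suc m \<and> int n \<in> range r}
      = (if int m \<in> range r then 1 else 0) + card {n. n < m \<and> int n \<in> range r}"
    by simp
  moreover have "fps_of_poly [:1, -1 :: rat:] = 1 - fps_X"
    by (simp add: fps_of_poly_pCons fps_const_neg[symmetric] del: fps_const_neg)
  ultimately show ?thesis
    by (simp only: right_diff_distrib)
      (simp add: poincare_series_def poincare_coeff_prime_powers[OF assms])
qed

theorem proposition4p28:
  fixes r :: "nat \<Rightarrow> int"
  assumes "almost_sparse r"
  shows "\<not> rational_fps
    (poincare_series {vec x :: 'p :: prime_card padic ^ 1 | x. x \<in> prime_powers_at (range r)})"
    (is "\<not> rational_fps ?F")
proof
  assume "rational_fps ?F"
  then have "rational_fps (?F * fps_of_poly [:1, -1:])" by (rule rational_fps_mult_poly)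
  then obtain N d where near: "\<And>a. a \<ge> N \<Longrightarrow> fps_nth (?F * fps_of_poly [:1, -1:]) a \<noteq> 0 \<Longrightarrow>
      \<exists>k<a. a \<le> k + d \<and> fps_nth (?F * fps_of_poly [:1, -1:]) k \<noteq> 0"
    using rational_fps_nonzero_coeff_nearby by blast
  have mono: "strict_mono r" using assms unfolding almost_sparse_def by blast
  note coeff = poincare_series_prime_powers_diff[OF mono, where 'p = 'p]
  obtain n where n: "n \<ge> N + nat (- r 0)" and gap: "r (Suc n) - r n > int d"
    using almost_sparse_gaps_unbounded[OF assms] by blast
  have large: "r n \<ge> int N" using strict_mono_int_growth[OF mono, of n] n by linarith
  \<comment> \<open>The coefficient at \<open>b + 1\<close> records \<open>b \<in> R\<close>; the preceding gap in \<open>R\<close> is longer than \<open>d\<close>.\<close>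
  define b where "b = nat (r (Suc n))"
  have b: "int b = r (Suc n)" using large gap unfolding b_def by linarith
  then have "int b \<in> range r" by simp
  moreover have "Suc b \<ge> N" using b large gap by linarith
  ultimately obtain k where k: "k < Suc b" "Suc b \<le> k + d"
    and nz: "fps_nth (?F * fps_of_poly [:1, -1:]) k \<noteq> 0"
    using near[of "Suc b"] coeff[of b] by auto
  have "k \<noteq> 0" using k b large gap by linarith
  then obtain c where c: "k = Suc c" using not0_implies_Suc by blast
  with nz coeff[of c] obtain i where i: "int c = r i" by (auto split: if_splits)
  have "r n < r i" "r i < r (Suc n)" using i c k b gap by linarith+
  then show False using mono by (simp add: strict_mono_less)
qed

end
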